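(* Let $H$ be a graph with $\chi(H)=3$ that has a critical edge and contains a triangle. Then ${\delta_{\text{lin-rem}}}(H)\leq\frac13$.
   Context: Copies of $H$ are labeled copies. For $\varepsilon>0$ and $\gamma\in[0,1]$, $\delta(\varepsilon,H;\gamma)$ is the maximum $\delta\in[0,1]$ such that every $n$-vertex graph with minimum degree at least $\gamma n$ containing $\varepsilon n^2$ edge-disjoint copies of $H$ contains at least $\delta n^{v(H)}$ copies of $H$. ${\delta_{\text{lin-rem}}}(H)$ is the infimum of those $\gamma$ for which there is $\mu=\mu(\gamma)>0$ with $\delta(\varepsilon,H;\gamma)\geq\mu\varepsilon$ for all $\varepsilon>0$. An edge $xy$ of $H$ is critical if $\chi(H-xy)<\chi(H)$.
   Formalization: In the definition of δ_lin-rem, "for all ε>0" is read as "for all ε in (0,1]": as δ(ε,H;γ) ≤ 1 by definition, με ≤ δ fails for every ε > 1/μ, so no γ would qualify; for ε > 1 no nonempty graph has εn² edge-disjoint copies. Host graphs have natural-number vertices. *)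

theory Defs
  imports Complex_Main "HOL-Library.FuncSet"
begin

type_synonym 'a ugraph = "'a set \<times> 'a set set"

abbreviation verts :: "'a ugraph \<Rightarrow> 'a set" where
  "verts G \<equiv> fst G"

abbreviation edges :: "'a ugraph \<Rightarrow> 'a set set" where
  "edges G \<equiv> snd G"

definition fin_graph :: "'a ugraph \<Rightarrow> bool" where
  "fin_graph G \<longleftrightarrow> finite (verts G) \<and> (\<forall>e\<in>edges G. e \<subseteq> verts G \<and> card e = 2)"

definition degree :: "'a ugraph \<Rightarrow> 'a \<Rightarrow> nat" where
  "degree G v = card {e \<in> edges G. v \<in> e}"

definition min_degree_ge :: "'a ugraph \<Rightarrow> real \<Rightarrow> bool" where
  "min_degree_ge G d \<longleftrightarrow> (\<forall>v\<in>verts G. d \<le> real (degree G v))"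

definition proper_colouring :: "'a ugraph \<Rightarrow> nat \<Rightarrow> ('a \<Rightarrow> nat) \<Rightarrow> bool" where
  "proper_colouring G k c \<longleftrightarrow>
     (\<forall>v\<in>verts G. c v < k) \<and> (\<forall>x y. {x, y} \<in> edges G \<longrightarrow> c x \<noteq> c y)"

definition chromatic_number :: "'a ugraph \<Rightarrow> nat" where
  "chromatic_number G = (LEAST k. \<exists>c. proper_colouring G k c)"

definition delete_edge :: "'a ugraph \<Rightarrow> 'a set \<Rightarrow> 'a ugraph" where
  "delete_edge G e = (verts G, edges G - {e})"

definition critical_edge :: "'a ugraph \<Rightarrow> 'a set \<Rightarrow> bool" where
  "critical_edge G e \<longleftrightarrow>
     e \<in> edges G \<and> chromatic_number (delete_edge G e) < chromatic_number G"

definition contains_triangle :: "'a ugraph \<Rightarrow> bool" where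
  "contains_triangle G \<longleftrightarrow>
     (\<exists>x y z. {x, y} \<in> edges G \<and> {y, z} \<in> edges G \<and> {x, z} \<in> edges G)"

text \<open>Labelled, not necessarily induced copies. Maps are extensional, so that two copies are
  equal iff they agree on the vertices of \<open>H\<close>.\<close>

definition copies :: "'a ugraph \<Rightarrow> 'b ugraph \<Rightarrow> ('a \<Rightarrow> 'b) set" where
  "copies H G =
     {f \<in> verts H \<rightarrow>\<^sub>E verts G. inj_on f (verts H) \<and> (\<forall>e\<in>edges H. f ` e \<in> edges G)}"

definition copy_edges :: "'a ugraph \<Rightarrow> ('a \<Rightarrow> 'b) \<Rightarrow> 'b set set" where
  "copy_edges H f = (\<lambda>e. f ` e) ` edges H"

definition has_edge_disjoint_copies :: "'a ugraph \<Rightarrow> 'b ugraph \<Rightarrow> real \<Rightarrow> bool" where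
  "has_edge_disjoint_copies H G m \<longleftrightarrow>
     (\<exists>F \<subseteq> copies H G.
        (\<forall>f\<in>F. \<forall>g\<in>F. f \<noteq> g \<longrightarrow> copy_edges H f \<inter> copy_edges H g = {}) \<and> m \<le> real (card F))"

text \<open>Every finite graph is isomorphic to one with vertices in \<^typ>\<open>nat\<close>, so it suffices to let the
  host graph range over these.\<close>

definition removal_bound :: "real \<Rightarrow> 'a ugraph \<Rightarrow> real \<Rightarrow> real \<Rightarrow> bool" where
  "removal_bound \<epsilon> H \<gamma> \<delta> \<longleftrightarrow>
     (\<forall>(G :: nat ugraph) n. fin_graph G \<longrightarrow> card (verts G) = n \<longrightarrow>
        min_degree_ge G (\<gamma> * real n) \<longrightarrow>
        has_edge_disjoint_copies H G (\<epsilon> * real n ^ 2) \<longrightarrow>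
        \<delta> * real n ^ card (verts H) \<le> real (card (copies H G)))"

definition removal_delta :: "real \<Rightarrow> 'a ugraph \<Rightarrow> real \<Rightarrow> real" where
  "removal_delta \<epsilon> H \<gamma> = (GREATEST \<delta>. 0 \<le> \<delta> \<and> \<delta> \<le> 1 \<and> removal_bound \<epsilon> H \<gamma> \<delta>)"

text \<open>The maximum above is attained.\<close>

lemma removal_delta_greatest:
  shows removal_delta_in: "0 \<le> removal_delta \<epsilon> H \<gamma> \<and> removal_delta \<epsilon> H \<gamma> \<le> 1 \<and>
            removal_bound \<epsilon> H \<gamma> (removal_delta \<epsilon> H \<gamma>)"
    and removal_delta_upper: "\<And>\<delta>. \<lbrakk>0 \<le> \<delta>; \<delta> \<le> 1; removal_bound \<epsilon> H \<gamma> \<delta>\<rbrakk> \<Longrightarrow> \<delta> \<le> removal_delta \<epsilon> H \<gamma>"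
proof -
  define P where "P = (\<lambda>\<delta>. 0 \<le> \<delta> \<and> \<delta> \<le> 1 \<and> removal_bound \<epsilon> H \<gamma> \<delta>)"
  define s where "s = Sup (Collect P)"
  have P0: "P 0" by (simp add: P_def removal_bound_def)
  have bdd: "bdd_above (Collect P)" by (rule bdd_aboveI[of _ 1]) (simp add: P_def)
  have upper: "x \<le> s" if "P x" for x
    unfolding s_def using that bdd by (intro cSup_upper) auto
  have least: "s \<le> c" if "\<And>x. P x \<Longrightarrow> x \<le> c" for c
    unfolding s_def using that P0 by (intro cSup_least) auto
  have "removal_bound \<epsilon> H \<gamma> s"
    unfolding removal_bound_def
  proof (intro allI impI)
    fix G :: "nat ugraph" and n
    assume a: "fin_graph G" "card (verts G) = n" "min_degree_ge G (\<gamma> * real n)"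
      "has_edge_disjoint_copies H G (\<epsilon> * real n ^ 2)"
    let ?N = "real n ^ card (verts H)"
    show "s * ?N \<le> real (card (copies H G))"
    proof (cases "?N = 0")
      case False
      then have pos: "?N > 0" by (metis less_eq_real_def of_nat_0_le_iff zero_le_power)
      have "s \<le> real (card (copies H G)) / ?N"
      proof (rule least)
        fix x assume "P x"
        then have "x * ?N \<le> real (card (copies H G))"
          using a unfolding P_def removal_bound_def by blast
        then show "x \<le> real (card (copies H G)) / ?N"
          using pos by (simp add: pos_le_divide_eq)
      qed
      then show ?thesis using pos by (simp add: pos_le_divide_eq)
    qed (simp only: mult_zero_right of_nat_0_le_iff)
  qed
  then have Ps: "P s" using upper[OF P0] least[of 1] by (auto simp: P_def)
  have "removal_delta \<epsilon> H \<gamma> = s"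
    unfolding removal_delta_def P_def[symmetric]
    using Greatest_equality[of P s] Ps upper by (simp add: P_def)
  then show "0 \<le> removal_delta \<epsilon> H \<gamma> \<and> removal_delta \<epsilon> H \<gamma> \<le> 1 \<and>
            removal_bound \<epsilon> H \<gamma> (removal_delta \<epsilon> H \<gamma>)"
    and "\<And>\<delta>. \<lbrakk>0 \<le> \<delta>; \<delta> \<le> 1; removal_bound \<epsilon> H \<gamma> \<delta>\<rbrakk> \<Longrightarrow> \<delta> \<le> removal_delta \<epsilon> H \<gamma>"
    using Ps upper by (auto simp: P_def)
qed

text \<open>The parameter \<open>\<epsilon>\<close> ranges over \<open>(0, 1]\<close>: a nonempty graph on \<open>n\<close> vertices has fewer than \<open>n\<^sup>2\<close>
  edges, so larger \<open>\<epsilon>\<close> are vacuous, while the cap \<open>\<delta> \<le> 1\<close> would then make \<open>\<mu> * \<epsilon> \<le> \<delta>\<close> fail.\<close>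

definition delta_lin_rem :: "'a ugraph \<Rightarrow> real" where
  "delta_lin_rem H =
     Inf {\<gamma>. 0 \<le> \<gamma> \<and> \<gamma> \<le> 1 \<and>
            (\<exists>\<mu>>0. \<forall>\<epsilon>. 0 < \<epsilon> \<and> \<epsilon> \<le> 1 \<longrightarrow> \<mu> * \<epsilon> \<le> removal_delta \<epsilon> H \<gamma>)}"

end

theory Submission
  imports Defs
begin

text \<open>Let \<open>xy\<close> be a critical edge of \<open>H\<close>. Deleting it leaves a bipartite graph with \<open>x\<close> and \<open>y\<close> on
  the same side, so \<open>H\<close> embeds into a complete bipartite graph with one edge added inside a part.
  If \<open>\<gamma> > 1/3\<close>, the degrees of the three vertices of a triangle of the host graph add up to more
  than \<open>n\<close>, so some edge of the triangle has a common neighbourhood \<open>W\<close> of linear size. Since the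
  vertices of \<open>W\<close> have linear degree, the bipartite graph between \<open>W\<close> and the whole vertex set is
  dense and, by the counting argument of Kovari, Sos and Turan, the edge is the image of
  \<open>xy\<close> in a positive proportion of all \<open>n ^ (v(H) - 2)\<close> conceivable copies of \<open>H\<close>. Edge-disjoint
  copies of \<open>H\<close> contain edge-disjoint triangles and hence provide different such edges.\<close>

subsection \<open>Counting bicliques in dense bipartite relations\<close>

lemma sum_card_swap:
  assumes "finite A" "finite B"
  shows "(\<Sum>a\<in>A. card {b\<in>B. R a b}) = (\<Sum>b\<in>B. card {a\<in>A. R a b})"
proof -
  have "(\<Sum>a\<in>A. card {b\<in>B. R a b}) = (\<Sum>a\<in>A. \<Sum>b\<in>B. if R a b then 1 else 0)"
    using assms by (intro sum.cong refl) (simp flip: sum.inter_filter)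
  also have "\<dots> = (\<Sum>b\<in>B. \<Sum>a\<in>A. if R a b then 1 else 0)"
    by (rule sum.swap)
  also have "\<dots> = (\<Sum>b\<in>B. card {a\<in>A. R a b})"
    using assms by (intro sum.cong refl) (simp flip: sum.inter_filter)
  finally show ?thesis .
qed

text \<open>Indices with values below \<open>c / 2 * M\<close> contribute at most half of the
  assumed lower bound on the sum. The other half comes from the large values, each of which
  contributes at most \<open>M\<close>.\<close>

lemma many_large_values:
  fixes f :: "'i \<Rightarrow> real"
  assumes "finite I" and "0 < M" and le: "\<And>i. i \<in> I \<Longrightarrow> f i \<le> M" and "0 \<le> c"
    and sum: "c * M * card I \<le> sum f I"
  shows "c / 2 * card I \<le> card {i\<in>I. c / 2 * M \<le> f i}"
proof -
  let ?L = "{i\<in>I. c / 2 * M \<le> f i}"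
  have "sum f I \<le> (\<Sum>i\<in>I. (if c / 2 * M \<le> f i then M else 0) + c / 2 * M)"
    using le assms(2,4) by (intro sum_mono) (auto simp: add_increasing2)
  also have "\<dots> = M * card ?L + c / 2 * M * card I"
    using \<open>finite I\<close> by (simp add: sum.distrib flip: sum.inter_filter)
  finally have "M * (c / 2 * card I) \<le> M * card ?L"
    using sum by (simp add: algebra_simps)
  then show ?thesis using \<open>0 < M\<close> by simp
qed

text \<open>Averaging twice replaces the usual convexity argument. Many \<open>v\<close> are related
  to a positive proportion of \<open>W\<close> and so lie in \<open>N T\<close> for many
  \<open>T\<close>. Double counting the pairs \<open>(T, v)\<close> then shows that many
  \<open>T\<close> have a common neighbourhood of size at least \<open>c * card V\<close>, into
  which \<open>A\<close> can be mapped freely. Maps need not be injective, so that all counts are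
  plain powers.\<close>

lemma many_biclique_maps:
  fixes R :: "'w \<Rightarrow> 'v \<Rightarrow> bool" and A :: "'a set" and B :: "'b set" and \<gamma> :: real
  assumes "finite V" "V \<noteq> {}" "finite W" "W \<noteq> {}" "finite A" "finite B" and "0 < \<gamma>"
    and deg: "\<And>w. w \<in> W \<Longrightarrow> \<gamma> * card V \<le> card {v\<in>V. R w v}"
  defines "c \<equiv> (\<gamma> / 2) ^ Suc (card B) / 2"
  shows "c ^ Suc (card A) * card W ^ card B * card V ^ card A
    \<le> card (SIGMA T : B \<rightarrow>\<^sub>E W. A \<rightarrow>\<^sub>E {v\<in>V. \<forall>p\<in>B. R (T p) v})"
proof -
  define N where "N T = {v\<in>V. \<forall>p\<in>B. R (T p) v}" for T
  define d where "d v = card {w\<in>W. R w v}" for v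
  let ?T = "B \<rightarrow>\<^sub>E W"
  have pos: "0 < real (card V)" "0 < real (card W)" and c0: "0 < c"
    using assms by (auto simp: card_gt_0_iff c_def)
  have finT: "finite ?T" using assms by (intro finite_PiE) auto
  have cardT: "card ?T = card W ^ card B" using \<open>finite B\<close> by (simp add: card_PiE)
  have finN: "finite (N T)" for T using \<open>finite V\<close> by (simp add: N_def)

  let ?V' = "{v\<in>V. \<gamma> / 2 * card W \<le> d v}"
  have "\<gamma> * card W * card V \<le> (\<Sum>w\<in>W. real (card {v\<in>V. R w v}))"
    using sum_mono[of W "\<lambda>w. \<gamma> * card V", OF deg] by (simp add: mult_ac)
  also have "\<dots> = (\<Sum>v\<in>V. real (d v))"
    unfolding d_def using arg_cong[OF sum_card_swap[OF \<open>finite W\<close> \<open>finite V\<close>, of R], of real]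
    by (simp only: of_nat_sum)
  finally have V': "\<gamma> / 2 * card V \<le> card ?V'"
    using assms(1,3,7) pos
    by (intro many_large_values) (auto simp: d_def intro!: card_mono)

  have count: "card {T\<in>?T. v \<in> N T} = d v ^ card B" if "v \<in> V" for v
  proof -
    have "{T\<in>?T. v \<in> N T} = B \<rightarrow>\<^sub>E {w\<in>W. R w v}"
      using that by (auto simp: N_def PiE_iff extensional_def)
    then show ?thesis using \<open>finite B\<close> by (simp add: card_PiE d_def)
  qed
  \<comment> \<open>One factor \<open>\<gamma> / 2\<close> is the proportion of good vertices
    \<open>v\<close>; the other \<open>card B\<close> factors bound from below the proportion of
    maps \<open>T\<close> with \<open>v \<in> N T\<close>. Their product is \<open>2 * c\<close>, so
    that the loss of a factor 2 in the second averaging leaves \<open>c\<close>.\<close>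
  have "2 * c * card V * card ?T = \<gamma> / 2 * card V * (\<gamma> / 2 * card W) ^ card B"
    by (simp add: c_def cardT power_mult_distrib power_divide)
  also have "\<dots> \<le> card ?V' * (\<gamma> / 2 * card W) ^ card B"
    using V' \<open>0 < \<gamma>\<close> by (intro mult_right_mono) auto
  also have "\<dots> = (\<Sum>v\<in>?V'. (\<gamma> / 2 * card W) ^ card B)" by simp
  also have "\<dots> \<le> (\<Sum>v\<in>?V'. real (d v) ^ card B)"
    using \<open>0 < \<gamma>\<close> by (intro sum_mono power_mono) auto
  also have "\<dots> \<le> (\<Sum>v\<in>V. real (d v) ^ card B)"
    using \<open>finite V\<close> by (intro sum_mono2) auto
  also have "\<dots> = real (\<Sum>v\<in>V. card {T\<in>?T. v \<in> N T})"
    by (simp add: count)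
  also have "\<dots> = real (\<Sum>T\<in>?T. card {v\<in>V. v \<in> N T})"
    using sum_card_swap[OF finT \<open>finite V\<close>, of "\<lambda>T v. v \<in> N T"] by simp
  also have "\<dots> = (\<Sum>T\<in>?T. real (card (N T)))"
    by (simp add: N_def)
  finally have "2 * c / 2 * card ?T \<le> card {T\<in>?T. 2 * c / 2 * card V \<le> card (N T)}"
    using finT pos c0 \<open>finite V\<close>
    by (intro many_large_values) (auto simp: N_def intro!: card_mono)
  then have T': "c * card ?T \<le> card {T\<in>?T. c * card V \<le> card (N T)}" (is "_ \<le> real (card ?T')")
    by simp

  have "c ^ Suc (card A) * card W ^ card B * card V ^ card A
      = c * card ?T * (c * card V) ^ card A"
    by (simp add: cardT power_mult_distrib mult_ac)
  also have "\<dots> \<le> card ?T' * (c * card V) ^ card A"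
    using T' c0 by (intro mult_right_mono) auto
  also have "\<dots> = (\<Sum>T\<in>?T'. (c * card V) ^ card A)" by simp
  also have "\<dots> \<le> (\<Sum>T\<in>?T'. real (card (N T)) ^ card A)"
    using c0 by (intro sum_mono power_mono) auto
  also have "\<dots> \<le> (\<Sum>T\<in>?T. real (card (N T)) ^ card A)"
    using finT by (intro sum_mono2) auto
  also have "\<dots> = card (SIGMA T : ?T. A \<rightarrow>\<^sub>E N T)"
    using finT \<open>finite A\<close> finN by (subst card_SigmaI) (auto simp: card_PiE intro!: finite_PiE)
  finally show ?thesis by (simp add: N_def)
qed

subsection \<open>Neighbourhoods\<close>

definition neighbourhood :: "'a ugraph \<Rightarrow> 'a \<Rightarrow> 'a set" where
  "neighbourhood G v = {w \<in> verts G. {v, w} \<in> edges G}"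

lemma edgeD:
  assumes "fin_graph G" "{u, v} \<in> edges G"
  shows "u \<in> verts G" "v \<in> verts G" "u \<noteq> v"
  using assms by (auto simp: fin_graph_def card_2_iff)

lemma edgeE:
  assumes "fin_graph G" "e \<in> edges G"
  obtains u v where "e = {u, v}" "u \<noteq> v"
  using assms by (metis card_2_iff fin_graph_def)

lemma degree_eq_card_neighbourhood:
  assumes "fin_graph G"
  shows "degree G v = card (neighbourhood G v)"
proof -
  have "bij_betw (\<lambda>w. {v, w}) (neighbourhood G v) {e \<in> edges G. v \<in> e}"
  proof (rule bij_betwI')
    fix e assume e: "e \<in> {e \<in> edges G. v \<in> e}"
    then obtain a b where "e = {a, b}" "{a, b} \<in> edges G" "v = a \<or> v = b"
      using edgeE[OF assms] by blast
    then obtain w where "e = {v, w}" "{v, w} \<in> edges G"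
      by (metis insert_commute)
    then show "\<exists>w\<in>neighbourhood G v. e = {v, w}"
      using edgeD(2)[OF assms] by (auto simp: neighbourhood_def)
  qed (auto simp: neighbourhood_def doubleton_eq_iff)
  then show ?thesis by (simp add: degree_def bij_betw_same_card)
qed

text \<open>By inclusion-exclusion, the three degrees add up to at most the number of vertices plus
  the three codegrees. Hence the codegrees have average at least
  \<open>(\<gamma> - 1 / 3) * card (verts G)\<close>, and one of them reaches it. This is where the
  threshold 1/3 arises.\<close>

lemma triangle_has_edge_of_large_codegree:
  fixes \<gamma> :: real
  assumes G: "fin_graph G" and deg: "min_degree_ge G (\<gamma> * card (verts G))"
    and tri: "{u, v} \<in> edges G" "{v, w} \<in> edges G" "{u, w} \<in> edges G"
  obtains s t where "{s, t} \<in> {{u, v}, {v, w}, {u, w}}"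
    "(\<gamma> - 1 / 3) * card (verts G) \<le> card (neighbourhood G s \<inter> neighbourhood G t)"
proof -
  let ?N = "neighbourhood G"
  have fin: "finite (?N z)" for z
    using G by (simp add: fin_graph_def neighbourhood_def)
  have "card (?N u \<union> ?N v \<union> ?N w) \<le> card (verts G)"
    using G by (intro card_mono) (auto simp: fin_graph_def neighbourhood_def)
  moreover have "card ((?N u \<union> ?N v) \<inter> ?N w) \<le> card (?N u \<inter> ?N w) + card (?N v \<inter> ?N w)"
    using card_Un_le[of "?N u \<inter> ?N w" "?N v \<inter> ?N w"] by (simp add: Int_Un_distrib2)
  ultimately have "real (card (?N u) + card (?N v) + card (?N w))
      \<le> card (verts G) + card (?N u \<inter> ?N v) + card (?N v \<inter> ?N w) + card (?N u \<inter> ?N w)"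
    using card_Un_Int[of "?N u" "?N v"] card_Un_Int[of "?N u \<union> ?N v" "?N w"] fin by simp
  moreover have "\<gamma> * card (verts G) \<le> card (?N u)" "\<gamma> * card (verts G) \<le> card (?N v)"
    "\<gamma> * card (verts G) \<le> card (?N w)"
    using deg edgeD[OF G tri(1)] edgeD[OF G tri(2)]
    by (auto simp: min_degree_ge_def degree_eq_card_neighbourhood[OF G])
  ultimately have "3 * ((\<gamma> - 1 / 3) * card (verts G))
      \<le> real (card (?N u \<inter> ?N v)) + card (?N v \<inter> ?N w) + card (?N u \<inter> ?N w)"
    by (simp add: algebra_simps)
  then consider "(\<gamma> - 1 / 3) * card (verts G) \<le> card (?N u \<inter> ?N v)"
    | "(\<gamma> - 1 / 3) * card (verts G) \<le> card (?N v \<inter> ?N w)"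
    | "(\<gamma> - 1 / 3) * card (verts G) \<le> card (?N u \<inter> ?N w)"
    by linarith
  then show thesis by cases (use that in auto)
qed

subsection \<open>Graphs with a critical edge\<close>

text \<open>Giving all vertices different colours is proper, so the \<open>LEAST\<close> in the
  definition ranges over a nonempty set.\<close>

lemma chromatic_number_attained:
  assumes "fin_graph G"
  obtains c where "proper_colouring G (chromatic_number G) c"
proof -
  obtain c where "bij_betw c (verts G) {0..<card (verts G)}"
    using ex_bij_betw_finite_nat[of "verts G"] assms unfolding fin_graph_def by metis
  then have "proper_colouring G (card (verts G)) c"
    using edgeD[OF assms] by (auto simp: proper_colouring_def bij_betw_def inj_on_eq_iff)
  then have "\<exists>k c. proper_colouring G k c" by blast
  then have "\<exists>c. proper_colouring G (chromatic_number G) c"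
    unfolding chromatic_number_def by (rule LeastI_ex)
  then show thesis using that by blast
qed

text \<open>Without \<open>e\<close> there is a proper colouring with colours below 2. It must give
  both ends of \<open>e\<close> the same colour, since otherwise it would be proper for
  \<open>H\<close> too. \<open>B\<close> is the opposite colour class, and \<open>A\<close> is the
  class of \<open>x\<close> and \<open>y\<close> without these two.\<close>

lemma critical_edge_bipartition:
  assumes H: "fin_graph H" and chi: "chromatic_number H = 3" and crit: "critical_edge H e"
  obtains x y A B where "e = {x, y}" "x \<noteq> y" "verts H = {x, y} \<union> A \<union> B"
    "{x, y} \<inter> A = {}" "{x, y} \<inter> B = {}" "A \<inter> B = {}"
    "\<And>d. d \<in> edges H \<Longrightarrow> d \<noteq> e \<Longrightarrow> \<exists>p\<in>{x, y} \<union> A. \<exists>q\<in>B. d = {p, q}"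
proof -
  let ?H = "delete_edge H e"
  have e: "e \<in> edges H" and less: "chromatic_number ?H < 3"
    using crit chi by (auto simp: critical_edge_def)
  obtain x y where xy: "e = {x, y}" "x \<noteq> y" using edgeE[OF H e] .
  have V: "x \<in> verts H" "y \<in> verts H" using edgeD[OF H] e xy by auto
  have "fin_graph ?H" using H by (auto simp: fin_graph_def delete_edge_def)
  then obtain c where "proper_colouring ?H (chromatic_number ?H) c"
    by (rule chromatic_number_attained)
  then have c: "\<And>v. v \<in> verts H \<Longrightarrow> c v < 2"
    "\<And>p q. {p, q} \<in> edges H \<Longrightarrow> {p, q} \<noteq> e \<Longrightarrow> c p \<noteq> c q"
    using less by (fastforce simp: proper_colouring_def delete_edge_def)+
  have cxy: "c x = c y"
  proof (rule ccontr)
    assume "c x \<noteq> c y"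
    then have "proper_colouring H 2 c"
      using c xy by (fastforce simp: proper_colouring_def doubleton_eq_iff)
    then have "chromatic_number H \<le> 2"
      unfolding chromatic_number_def by (intro Least_le) blast
    then show False using chi by simp
  qed
  define A where "A = {v \<in> verts H. c v = c x} - {x, y}"
  define B where "B = {v \<in> verts H. c v \<noteq> c x}"
  show thesis
  proof (rule that[OF xy])
    fix d assume d: "d \<in> edges H" "d \<noteq> e"
    obtain p q where pq: "d = {p, q}" using edgeE[OF H d(1)] by blast
    have "p \<in> verts H" "q \<in> verts H" "c p \<noteq> c q"
      using edgeD[OF H] c(2) d pq by auto
    then have "p \<in> {x, y} \<union> A \<and> q \<in> B \<or> q \<in> {x, y} \<union> A \<and> p \<in> B"
      using c(1)[of p] c(1)[of q] c(1)[OF V(1)] by (auto simp: A_def B_def)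
    then show "\<exists>p\<in>{x, y} \<union> A. \<exists>q\<in>B. d = {p, q}"
      using pq by (metis insert_commute)
  qed (use V cxy in \<open>auto simp: A_def B_def\<close>)
qed

subsection \<open>Copies extending a given edge\<close>

text \<open>A collision costs one more degree of freedom beyond the two fixed values, and at most
  \<open>card U ^ 2\<close> pairs can collide.\<close>

lemma card_noninjective_maps_le:
  assumes "finite U" "finite V" "x \<in> U" "y \<in> U" "x \<noteq> y" "u \<noteq> v"
  shows "card {f \<in> U \<rightarrow>\<^sub>E V. f x = u \<and> f y = v \<and> \<not> inj_on f U} \<le> card U ^ 2 * card V ^ (card U - 3)"
proof -
  \<comment> \<open>As \<open>u \<noteq> v\<close>, a colliding pair is not \<open>{x, y}\<close>,
    so it can be ordered with its second member \<open>q\<close> outside \<open>{x, y}\<close>. Then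
    \<open>x\<close>, \<open>y\<close>, \<open>q\<close> are three distinct vertices, which gives
    the exponent \<open>card U - 3\<close>.\<close>
  let ?P = "U \<times> (U - {x, y})"
  define S where "S = (\<lambda>(p, q). {f \<in> U \<rightarrow>\<^sub>E V. f x = u \<and> f y = v \<and> p \<noteq> q \<and> f p = f q})"
  have "finite (U \<rightarrow>\<^sub>E V)" using assms by (intro finite_PiE) auto
  then have finS: "finite (S pq)" for pq by (auto simp: S_def split: prod.split)
  have "card (S pq) \<le> card V ^ (card U - 3)" if pq: "pq \<in> ?P" for pq
  proof -
    obtain p q where [simp]: "pq = (p, q)" by fastforce
    let ?U = "U - {x, y, q}"
    \<comment> \<open>The values at \<open>x\<close> and \<open>y\<close> are prescribed, and the
      value at \<open>q\<close> is recovered from the one at \<open>p\<close>.\<close>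
    have "inj_on (\<lambda>f. restrict f ?U) (S pq)"
    proof (rule inj_onI)
      fix f g assume fg: "f \<in> S pq" "g \<in> S pq" and eq: "restrict f ?U = restrict g ?U"
      have off: "f z = g z" if "z \<noteq> q" for z
        using that fg fun_cong[OF eq, of z] by (auto simp: S_def PiE_iff extensional_def split: if_splits)
      then have "f q = g q" using fg by (auto simp: S_def)
      with off show "f = g" by (metis ext)
    qed
    moreover have "(\<lambda>f. restrict f ?U) ` S pq \<subseteq> ?U \<rightarrow>\<^sub>E V"
      by (auto simp: S_def PiE_iff split: if_splits)
    moreover have "finite (?U \<rightarrow>\<^sub>E V)" using assms by (intro finite_PiE) auto
    ultimately have "card (S pq) \<le> card (?U \<rightarrow>\<^sub>E V)" by (rule card_inj_on_le)
    also have "\<dots> = card V ^ (card U - 3)"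
      using assms pq by (subst card_PiE) (auto simp: card_Diff_subset numeral_3_eq_3)
    finally show ?thesis .
  qed
  then have bound: "(\<Sum>pq\<in>?P. card (S pq)) \<le> card ?P * card V ^ (card U - 3)"
    by (metis sum_bounded_above of_nat_id)
  have "{f \<in> U \<rightarrow>\<^sub>E V. f x = u \<and> f y = v \<and> \<not> inj_on f U} \<subseteq> (\<Union>pq\<in>?P. S pq)"
  proof
    fix f assume f: "f \<in> {f \<in> U \<rightarrow>\<^sub>E V. f x = u \<and> f y = v \<and> \<not> inj_on f U}"
    then obtain p q where pq: "p \<in> U" "q \<in> U" "p \<noteq> q" "f p = f q" by (auto simp: inj_on_def)
    then have "p \<notin> {x, y} \<or> q \<notin> {x, y}" using f assms(6) by auto
    with pq have "(p, q) \<in> ?P \<or> (q, p) \<in> ?P" by auto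
    moreover have "f \<in> S (p, q)" "f \<in> S (q, p)" using f pq by (auto simp: S_def)
    ultimately show "f \<in> (\<Union>pq\<in>?P. S pq)" by blast
  qed
  then have "card {f \<in> U \<rightarrow>\<^sub>E V. f x = u \<and> f y = v \<and> \<not> inj_on f U} \<le> card (\<Union>pq\<in>?P. S pq)"
    using assms(1) finS by (intro card_mono) auto
  also have "\<dots> \<le> (\<Sum>pq\<in>?P. card (S pq))"
    using assms(1) by (intro card_UN_le) auto
  also note bound
  also have "card ?P * card V ^ (card U - 3) \<le> card U ^ 2 * card V ^ (card U - 3)"
    using assms(1) by (auto simp: card_cartesian_product power2_eq_square intro!: mult_right_mono card_mono)
  finally show ?thesis .
qed

lemma finite_copies: "fin_graph H \<Longrightarrow> fin_graph G \<Longrightarrow> finite (copies H G)"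
  unfolding copies_def fin_graph_def
  by (rule finite_subset[of _ "verts H \<rightarrow>\<^sub>E verts G"]) (auto intro: finite_PiE)

text \<open>With \<open>x\<close>, \<open>y\<close> sent to \<open>u\<close>, \<open>v\<close>, let
  \<open>B\<close> go into the common neighbourhood \<open>W\<close> of \<open>u\<close> and
  \<open>v\<close>, and \<open>A\<close> into the common neighbourhood of the image of
  \<open>B\<close>. All edges except \<open>{x, y}\<close> join \<open>B\<close> to the other side,
  so they are preserved. The choices are counted by \<open>many_biclique_maps\<close>; injectivity
  is left for later.\<close>

lemma many_homomorphisms_extending_edge:
  fixes H :: "'a ugraph" and G :: "'b ugraph" and \<alpha> \<gamma> :: real
  assumes H: "fin_graph H" and G: "fin_graph G"
    and VH: "verts H = {x, y} \<union> A \<union> B" "x \<noteq> y"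
      "{x, y} \<inter> A = {}" "{x, y} \<inter> B = {}" "A \<inter> B = {}"
    and EH: "\<And>d. d \<in> edges H \<Longrightarrow> d \<noteq> {x, y} \<Longrightarrow> \<exists>p\<in>{x, y} \<union> A. \<exists>q\<in>B. d = {p, q}"
    and deg: "min_degree_ge G (\<gamma> * card (verts G))" "0 < \<gamma>"
    and uv: "{u, v} \<in> edges G" "0 < \<alpha>"
      "\<alpha> * card (verts G) \<le> card (neighbourhood G u \<inter> neighbourhood G v)"
  shows "((\<gamma> / 2) ^ Suc (card B) / 2) ^ Suc (card A) * \<alpha> ^ card B * card (verts G) ^ (card (verts H) - 2)
    \<le> card {f \<in> verts H \<rightarrow>\<^sub>E verts G. f x = u \<and> f y = v \<and> (\<forall>e\<in>edges H. f ` e \<in> edges G)}"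
    (is "?c * _ * _ \<le> real (card ?Hom)")
proof -
  let ?V = "verts G" and ?n = "card (verts G)"
  define W where "W = neighbourhood G u \<inter> neighbourhood G v"
  define N where "N T = {s \<in> ?V. \<forall>p\<in>B. {T p, s} \<in> edges G}" for T :: "'a \<Rightarrow> 'b"
  let ?S = "SIGMA T : B \<rightarrow>\<^sub>E W. A \<rightarrow>\<^sub>E N T"
  have fin: "finite ?V" "finite W" "finite A" "finite B"
    using G H VH(1) by (auto simp: fin_graph_def W_def neighbourhood_def)
  have V: "u \<in> ?V" "v \<in> ?V" using edgeD[OF G uv(1)] by auto
  then have n: "0 < real ?n" using fin by (auto simp: card_gt_0_iff)
  have "0 < \<alpha> * ?n" using n uv(2) by simp
  then have W: "W \<noteq> {}" using uv(3) by (auto simp: W_def)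
  have WV: "w \<in> ?V" if "w \<in> W" for w using that by (simp add: W_def neighbourhood_def)
  have degW: "\<gamma> * ?n \<le> card {s \<in> ?V. {w, s} \<in> edges G}" if "w \<in> W" for w
    using deg(1) WV[OF that]
    by (auto simp: min_degree_ge_def degree_eq_card_neighbourhood[OF G] neighbourhood_def)

  \<comment> \<open>The value \<open>undefined\<close> off \<open>verts H\<close> makes the glued
    map extensional, as membership in \<open>?Hom\<close> demands.\<close>
  define \<phi> where "\<phi> = (\<lambda>(T, S) p. if p = x then u else if p = y then v else if p \<in> A then S p
    else if p \<in> B then T p else undefined :: 'b)"
  have "inj_on \<phi> ?S"
  proof (rule inj_onI, clarsimp simp only: mem_Sigma_iff prod.inject)
    fix T S T' S'
    assume *: "T \<in> B \<rightarrow>\<^sub>E W" "T' \<in> B \<rightarrow>\<^sub>E W" "S \<in> A \<rightarrow>\<^sub>E N T" "S' \<in> A \<rightarrow>\<^sub>E N T'"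
      and eq: "\<phi> (T, S) = \<phi> (T', S')"
    have "T p = T' p" for p
      using fun_cong[OF eq, of p] * VH(3-5)
      by (cases "p \<in> B") (auto simp: \<phi>_def PiE_iff extensional_def split: if_splits)
    moreover have "S p = S' p" for p
      using fun_cong[OF eq, of p] * VH(3-5)
      by (cases "p \<in> A") (auto simp: \<phi>_def PiE_iff extensional_def split: if_splits)
    ultimately show "T = T' \<and> S = S'" by auto
  qed
  moreover have "\<phi> ` ?S \<subseteq> ?Hom"
  proof clarify
    fix T S assume T: "T \<in> B \<rightarrow>\<^sub>E W" and S: "S \<in> A \<rightarrow>\<^sub>E N T"
    let ?f = "\<phi> (T, S)"
    have f: "?f x = u" "?f y = v" "\<And>p. p \<in> A \<Longrightarrow> ?f p = S p" "\<And>p. p \<in> B \<Longrightarrow> ?f p = T p"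
      using VH(2-5) by (auto simp: \<phi>_def)
    have "?f \<in> verts H \<rightarrow>\<^sub>E ?V"
    proof (rule PiE_I)
      fix p assume "p \<in> verts H"
      then show "?f p \<in> ?V"
        using VH(1) f V S T WV by (auto simp: N_def PiE_iff)
    qed (use VH(1) in \<open>auto simp: \<phi>_def\<close>)
    moreover have "?f ` d \<in> edges G" if d: "d \<in> edges H" for d
    proof (cases "d = {x, y}")
      case False
      then obtain p q where pq: "p \<in> {x, y} \<union> A" "q \<in> B" "d = {p, q}" using EH d by blast
      have Tq: "T q \<in> W" using T pq by auto
      have "{?f p, T q} \<in> edges G"
      proof (cases "p \<in> A")
        case True
        then show ?thesis using f S pq by (auto simp: N_def PiE_iff insert_commute)
      qed (use pq f Tq in \<open>auto simp: W_def neighbourhood_def\<close>)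
      then show ?thesis using pq f by simp
    qed (use f uv in simp)
    ultimately show "?f \<in> verts H \<rightarrow>\<^sub>E ?V \<and> ?f x = u \<and> ?f y = v \<and> (\<forall>e\<in>edges H. ?f ` e \<in> edges G)"
      using f by blast
  qed
  moreover have "finite ?Hom"
    using H fin(1) by (auto simp: fin_graph_def intro!: finite_PiE)
  ultimately have le: "card ?S \<le> card ?Hom" by (rule card_inj_on_le)

  have cardH: "card (verts H) - 2 = card B + card A"
    using VH fin by (simp add: card_Un_disjoint Int_Un_distrib Int_Un_distrib2 card_insert_if)
  have "?c * \<alpha> ^ card B * ?n ^ (card (verts H) - 2) = ?c * (\<alpha> * ?n) ^ card B * ?n ^ card A"
    by (simp add: cardH power_add power_mult_distrib mult_ac)
  also have "\<dots> \<le> ?c * real (card W) ^ card B * ?n ^ card A"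
    using uv(3) deg(2) \<open>0 < \<alpha> * ?n\<close>
    by (intro mult_right_mono mult_left_mono power_mono) (auto simp: W_def)
  also have "\<dots> \<le> card ?S"
    unfolding N_def using many_biclique_maps[of ?V W A B \<gamma> "\<lambda>w s. {w, s} \<in> edges G"]
      fin V W deg(2) degW by auto
  also have "\<dots> \<le> card ?Hom" using le by simp
  finally show ?thesis .
qed

text \<open>Non-injective maps are of lower order: by \<open>large\<close> they number at most half
  of the lower bound on the homomorphisms. The conclusion fixes only the unordered image of
  \<open>{x, y}\<close>, so that families belonging to different edges are disjoint.\<close>

lemma many_copies_extending_edge:
  fixes H :: "'a ugraph" and G :: "'b ugraph" and c :: real
  assumes H: "fin_graph H" and G: "fin_graph G" and h: "3 \<le> card (verts H)"
    and xy: "x \<in> verts H" "y \<in> verts H" "x \<noteq> y" and uv: "u \<noteq> v"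
    and hom: "c * card (verts G) ^ (card (verts H) - 2)
      \<le> card {f \<in> verts H \<rightarrow>\<^sub>E verts G. f x = u \<and> f y = v \<and> (\<forall>e\<in>edges H. f ` e \<in> edges G)}"
    and large: "2 * card (verts H) ^ 2 \<le> c * card (verts G)"
  shows "c / 2 * card (verts G) ^ (card (verts H) - 2) \<le> card {f \<in> copies H G. f ` {x, y} = {u, v}}"
proof -
  let ?U = "verts H" and ?V = "verts G"
  let ?h = "card ?U" and ?n = "card ?V"
  let ?Hom = "{f \<in> ?U \<rightarrow>\<^sub>E ?V. f x = u \<and> f y = v \<and> (\<forall>e\<in>edges H. f ` e \<in> edges G)}"
  let ?C = "{f \<in> copies H G. f ` {x, y} = {u, v}}"
  let ?D = "{f \<in> ?U \<rightarrow>\<^sub>E ?V. f x = u \<and> f y = v \<and> \<not> inj_on f ?U}"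
  have fin: "finite ?U" "finite ?V" using H G by (auto simp: fin_graph_def)
  have "card ?Hom \<le> card (?C \<union> ?D)"
    using fin finite_copies[OF H G] by (intro card_mono) (auto simp: copies_def intro!: finite_PiE)
  also have "\<dots> \<le> card ?C + card ?D" by (rule card_Un_le)
  also have "card ?D \<le> ?h ^ 2 * ?n ^ (?h - 3)"
    using fin xy uv by (rule card_noninjective_maps_le)
  finally have "real (card ?Hom) \<le> card ?C + real ?h ^ 2 * real ?n ^ (?h - 3)"
    by (simp flip: of_nat_power of_nat_mult of_nat_add)
  moreover have "real ?h ^ 2 * real ?n ^ (?h - 3) \<le> c / 2 * ?n * real ?n ^ (?h - 3)"
    using large by (intro mult_right_mono) auto
  moreover have "real ?n * real ?n ^ (?h - 3) = real ?n ^ (?h - 2)"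
    using h by (simp add: Suc_diff_Suc numeral_eq_Suc flip: power_Suc)
  ultimately show ?thesis using hom by (simp add: mult.assoc)
qed

section \<open>Linear removal above one third\<close>

text \<open>Each given copy \<open>f\<close> contains an edge \<open>d f\<close> that is the image
  of \<open>e\<close> in at least \<open>c / 2 * n ^ (card (verts H) - 2)\<close> copies of
  \<open>H\<close>, provided \<open>n\<close> is large. Edge-disjointness makes these edges
  distinct, so the contributions add up over \<open>F\<close>.\<close>

lemma linear_removal_above_third:
  fixes H :: "'a ugraph"
  assumes H: "fin_graph H" and chi: "chromatic_number H = 3" and crit: "critical_edge H e"
    and tri: "contains_triangle H" and \<gamma>: "1 / 3 < \<gamma>"
  obtains \<mu> where "0 < \<mu>" "\<mu> \<le> 1" "\<And>\<epsilon>. 0 < \<epsilon> \<Longrightarrow> removal_bound \<epsilon> H \<gamma> (\<mu> * \<epsilon>)"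
proof -
  obtain x y A B where xy: "e = {x, y}" "x \<noteq> y" and VH: "verts H = {x, y} \<union> A \<union> B"
    "{x, y} \<inter> A = {}" "{x, y} \<inter> B = {}" "A \<inter> B = {}"
    and EH: "\<And>d. d \<in> edges H \<Longrightarrow> d \<noteq> e \<Longrightarrow> \<exists>p\<in>{x, y} \<union> A. \<exists>q\<in>B. d = {p, q}"
    using critical_edge_bipartition[OF H chi crit] by metis
  obtain z1 z2 z3 where z: "{z1, z2} \<in> edges H" "{z2, z3} \<in> edges H" "{z1, z3} \<in> edges H"
    using tri by (auto simp: contains_triangle_def)
  let ?h = "card (verts H)"
  have "card {z1, z2, z3} \<le> ?h"
    using H edgeD[OF H z(1)] edgeD[OF H z(2)] by (intro card_mono) (auto simp: fin_graph_def)
  then have h: "3 \<le> ?h" using edgeD(3)[OF H] z by (simp add: card_insert_if)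

  define c where "c = ((\<gamma> / 2) ^ Suc (card B) / 2) ^ Suc (card A) * (\<gamma> - 1 / 3) ^ card B"
  define n0 where "n0 = max 1 (2 * real ?h ^ 2 / c)"
  \<comment> \<open>The bound 1 respects the cap on \<open>removal_delta\<close>,
    \<open>c / 2\<close> serves the case of large \<open>n\<close>, and the last term serves
    \<open>n < n0\<close>.\<close>
  define \<mu> where "\<mu> = min 1 (min (c / 2) (1 / n0 ^ (?h - 2)))"
  have c: "0 < c" using \<gamma> by (simp add: c_def)
  have n0: "1 \<le> n0" by (simp add: n0_def)
  have \<mu>: "0 < \<mu>" "\<mu> \<le> 1" "\<mu> \<le> c / 2" "\<mu> \<le> 1 / n0 ^ (?h - 2)"
    using c n0 by (auto simp: \<mu>_def)
  have "removal_bound \<epsilon> H \<gamma> (\<mu> * \<epsilon>)" if \<epsilon>: "0 < \<epsilon>" for \<epsilon>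
    unfolding removal_bound_def
  proof (intro allI impI)
    fix G :: "nat ugraph" and n
    assume G: "fin_graph G" and n: "card (verts G) = n" and deg: "min_degree_ge G (\<gamma> * n)"
      and "has_edge_disjoint_copies H G (\<epsilon> * real n ^ 2)"
    then obtain F where F: "F \<subseteq> copies H G" "\<epsilon> * real n ^ 2 \<le> card F"
      and disj: "\<And>f g. f \<in> F \<Longrightarrow> g \<in> F \<Longrightarrow> f \<noteq> g \<Longrightarrow> copy_edges H f \<inter> copy_edges H g = {}"
      unfolding has_edge_disjoint_copies_def by metis
    note finC = finite_copies[OF H G]
    have finF: "finite F" using F(1) finC by (rule finite_subset)
    have split: "real n ^ ?h = real n ^ 2 * real n ^ (?h - 2)"
      using h by (metis add_diff_inverse_nat le_trans linorder_not_less numeral_le_iff power_add semiring_norm(68,69,72))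
    show "\<mu> * \<epsilon> * real n ^ ?h \<le> card (copies H G)"
    proof (cases "real n < n0")
      case True
      \<comment> \<open>For small \<open>n\<close> the copies in \<open>F\<close> alone suffice,
        since the extra factor \<open>\<mu> * n ^ (?h - 2)\<close> is at most 1.\<close>
      have "\<mu> * real n ^ (?h - 2) \<le> 1 / n0 ^ (?h - 2) * n0 ^ (?h - 2)"
        using \<mu> n0 True by (intro mult_mono power_mono) auto
      then have "\<mu> * real n ^ (?h - 2) \<le> 1" using n0 by simp
      then have "\<epsilon> * real n ^ 2 * (\<mu> * real n ^ (?h - 2)) \<le> \<epsilon> * real n ^ 2"
        using \<epsilon> by (intro mult_left_le) auto
      also note F(2)
      also have "real (card F) \<le> card (copies H G)" using F(1) finC by (simp add: card_mono)
      finally show ?thesis by (simp add: split mult_ac)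
    next
      case False
      then have "2 * real ?h ^ 2 / c \<le> n" by (simp add: n0_def)
      then have large: "2 * real ?h ^ 2 \<le> c * n"
        using c by (simp add: pos_divide_le_eq mult.commute)
      let ?C = "\<lambda>d. {g \<in> copies H G. g ` e = d}"
      have "\<exists>d. d \<in> copy_edges H f \<and> c / 2 * real n ^ (?h - 2) \<le> card (?C d)" if "f \<in> F" for f
      proof -
        have img: "f ` d \<in> edges G" if "d \<in> edges H" for d
          using that \<open>f \<in> F\<close> F(1) by (auto simp: copies_def)
        have "{f z1, f z2} \<in> edges G" "{f z2, f z3} \<in> edges G" "{f z1, f z3} \<in> edges G"
          using z[THEN img] by simp_all
        then obtain u v where uv: "{u, v} \<in> {{f z1, f z2}, {f z2, f z3}, {f z1, f z3}}"
          and codeg: "(\<gamma> - 1 / 3) * n \<le> card (neighbourhood G u \<inter> neighbourhood G v)"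
          using triangle_has_edge_of_large_codegree[OF G, of \<gamma>] deg n by metis
        have "{u, v} \<in> {f ` {z1, z2}, f ` {z2, z3}, f ` {z1, z3}}"
          using uv by simp
        then have ce: "{u, v} \<in> copy_edges H f"
          using z unfolding copy_edges_def by blast
        then have uvE: "{u, v} \<in> edges G" using img by (auto simp: copy_edges_def)
        have "c * n ^ (?h - 2)
          \<le> card {f \<in> verts H \<rightarrow>\<^sub>E verts G. f x = u \<and> f y = v \<and> (\<forall>e\<in>edges H. f ` e \<in> edges G)}"
          unfolding c_def n[symmetric]
          using \<gamma> deg codeg uvE EH xy VH n by (intro many_homomorphisms_extending_edge[OF H G]) auto
        then have "c / 2 * n ^ (?h - 2) \<le> card (?C {u, v})"
          unfolding xy(1) n[symmetric]
          using large VH(1) xy(2) edgeD(3)[OF G uvE] n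
          by (intro many_copies_extending_edge[OF H G h]) auto
        then show ?thesis using ce by auto
      qed
      then have "\<exists>d. \<forall>f\<in>F. d f \<in> copy_edges H f \<and> c / 2 * real n ^ (?h - 2) \<le> card (?C (d f))"
        by (intro bchoice ballI)
      then obtain d where d: "\<And>f. f \<in> F \<Longrightarrow> d f \<in> copy_edges H f"
        "\<And>f. f \<in> F \<Longrightarrow> c / 2 * real n ^ (?h - 2) \<le> card (?C (d f))"
        by blast
      \<comment> \<open>A common edge would lie in both \<open>copy_edges H f\<close> and
        \<open>copy_edges H g\<close>. Hence the families \<open>?C (d f)\<close> are pairwise
        disjoint.\<close>
      have ne: "d f \<noteq> d g" if "f \<in> F" "g \<in> F" "f \<noteq> g" for f g
        using disj[OF that] d(1)[of f] d(1)[of g] that by auto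
      have "\<mu> * \<epsilon> * real n ^ ?h = \<epsilon> * real n ^ 2 * (\<mu> * real n ^ (?h - 2))"
        by (simp add: split mult_ac)
      also have "\<dots> \<le> card F * (c / 2 * real n ^ (?h - 2))"
        using F(2) \<mu> \<epsilon> by (intro mult_mono mult_right_mono) auto
      also have "\<dots> \<le> (\<Sum>f\<in>F. real (card (?C (d f))))"
        using d(2) by (intro sum_bounded_below) auto
      also have "\<dots> = card (\<Union>f\<in>F. ?C (d f))"
        using finF finC ne by (subst card_UN_disjoint) auto
      also have "\<dots> \<le> card (copies H G)"
        using finC by (auto intro!: card_mono)
      finally show ?thesis .
    qed
  qed
  with \<mu> show thesis using that by blast
qed

theorem theorem5p4:
  fixes H :: "'a ugraph"
  assumes "fin_graph H"
    and "chromatic_number H = 3"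
    and "\<exists>e. critical_edge H e"
    and "contains_triangle H"
  shows "delta_lin_rem H \<le> 1 / 3"
\<comment> \<open>It suffices to bound the infimum by every \<open>\<gamma>\<close> strictly between
  1/3 and 1; nothing is claimed at 1/3 itself.\<close>
proof (rule dense_ge_bounded[of _ 1])
  fix \<gamma> :: real assume \<gamma>: "1 / 3 < \<gamma>" "\<gamma> < 1"
  obtain \<mu> where \<mu>: "0 < \<mu>" "\<mu> \<le> 1" "\<And>\<epsilon>. 0 < \<epsilon> \<Longrightarrow> removal_bound \<epsilon> H \<gamma> (\<mu> * \<epsilon>)"
    using linear_removal_above_third assms \<gamma>(1) by metis
  have "\<mu> * \<epsilon> \<le> removal_delta \<epsilon> H \<gamma>" if "0 < \<epsilon>" "\<epsilon> \<le> 1" for \<epsilon>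
    \<comment> \<open>Both factors are at most 1, so \<open>\<mu> * \<epsilon>\<close> is an
      admissible candidate for the maximum.\<close>
    using \<mu> that by (intro removal_delta_upper) (auto simp: mult_le_one)
  then show "delta_lin_rem H \<le> \<gamma>"
    unfolding delta_lin_rem_def using \<gamma> \<mu>(1)
    by (intro cInf_lower bdd_belowI[of _ 0]) auto
qed simp

end
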